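(* Let $D(x)=1-2x-2x^2+x^3$ and define integer sequences by the formal power series expansions \[ \frac{4-16x+12x^2}{D(x)}=\sum_{n\ge0}a_nx^n,\ \frac{3+6x-9x^2}{D(x)}=\sum_{n\ge0}b_nx^n,\ \frac{2-20x+6x^2}{D(x)}=\sum_{n\ge0}c_nx^n, \] \[ \frac{4+8x-12x^2}{D(x)}=\sum_{n\ge0}d_nx^n,\ \frac{2+4x+6x^2}{D(x)}=\sum_{n\ge0}e_nx^n,\ \frac{5+10x-15x^2}{D(x)}=\sum_{n\ge0}f_nx^n. \] Then for all $n\ge0$, $a_n^4+b_n^4+c_n^4+d_n^4+e_n^4=f_n^4$. *)

theory Defs
  imports "HOL-Computational_Algebra.Formal_Power_Series"
begin

text \<open>
  Quotients of formal power series are formed over the field of rationals.  An integer sequence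
  is read as a rational formal power series through its ordinary generating function.
\<close>

definition D :: "rat fps" where
  "D = 1 - 2 * fps_X - 2 * fps_X ^ 2 + fps_X ^ 3"

definition int_gf :: "(nat \<Rightarrow> int) \<Rightarrow> rat fps" where
  "int_gf s = Abs_fps (\<lambda>n. of_int (s n))"

text \<open>
  The expansion of a quotient of an integer polynomial of degree at most two by \<open>D\<close>
  has integer coefficients, and it determines them.  So an assumption of the form
  \<open>int_gf s = (p + q * fps_X + r * fps_X ^ 2) / D\<close> defines the integer sequence \<open>s\<close>.
\<close>

fun coeff_seq :: "int \<Rightarrow> int \<Rightarrow> int \<Rightarrow> nat \<Rightarrow> int" where
  "coeff_seq p q r 0 = p"
| "coeff_seq p q r (Suc 0) = q + 2 * p"
| "coeff_seq p q r (Suc (Suc 0)) = r + 2 * (q + 2 * p) + 2 * p"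
| "coeff_seq p q r (Suc (Suc (Suc n))) =
     2 * coeff_seq p q r (Suc (Suc n)) + 2 * coeff_seq p q r (Suc n) - coeff_seq p q r n"

lemma int_gf_eq_iff: "int_gf s = int_gf t \<longleftrightarrow> s = t"
  by (auto simp: int_gf_def fps_eq_iff)

lemma int_gf_coeff_seq:
  "int_gf (coeff_seq p q r) = (of_int p + of_int q * fps_X + of_int r * fps_X ^ 2) / D"
proof -
  let ?N = "of_int p + of_int q * fps_X + of_int r * fps_X ^ 2 :: rat fps"
  let ?S = "int_gf (coeff_seq p q r)"
  have D0: "fps_nth D 0 \<noteq> 0"
    by (simp add: D_def)
  have exp: "?S * D = ?S - fps_const 2 * (fps_X * ?S) - fps_const 2 * (fps_X ^ 2 * ?S) + fps_X ^ 3 * ?S"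
    by (simp add: D_def algebra_simps numeral_fps_const)
  have "?S * D = ?N"
  proof (rule fps_ext)
    fix n
    have N: "fps_nth ?N n = (if n = 0 then of_int p else if n = 1 then of_int q
                              else if n = 2 then of_int r else 0)"
      by (auto simp: fps_of_int [symmetric] fps_X_power_nth)
    consider "n = 0" | "n = Suc 0" | "n = Suc (Suc 0)" | m where "n = Suc (Suc (Suc m))"
      by (metis not0_implies_Suc)
    then show "fps_nth (?S * D) n = fps_nth ?N n"
      unfolding exp N fps_add_nth fps_sub_nth fps_mult_left_const_nth
        fps_X_power_mult_nth fps_X_mult_nth
      by cases (simp_all add: int_gf_def numeral_2_eq_2 numeral_3_eq_3)
  qed
  then have "?S * D * inverse D = ?N * inverse D"
    by simp
  then show ?thesis
    using D0 by (simp add: fps_divide_unit mult.assoc inverse_mult_eq_1')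
qed

lemma ex1_int_gf_eq:
  "\<exists>!s. int_gf s = (of_int p + of_int q * fps_X + of_int r * fps_X ^ 2) / D"
  by (metis int_gf_coeff_seq int_gf_eq_iff)

end

theory Submission
  imports Defs
begin

text \<open>
  The numerators for \<open>b\<close>, \<open>d\<close>, \<open>f\<close> are 3, 4, 5 times \<open>1 + 2x - 3x\<^sup>2\<close>, so with \<open>u\<close> the sequence of
  that numerator the claim reads \<open>a\<^sup>4 + c\<^sup>4 + e\<^sup>4 = 288 u\<^sup>4\<close>.  Moreover \<open>a = c + e\<close>, hence
  \<open>a\<^sup>4 + c\<^sup>4 + e\<^sup>4 = 2 (c\<^sup>2 + c e + e\<^sup>2)\<^sup>2\<close>, and it suffices that \<open>c\<^sup>2 + c e + e\<^sup>2 = 12 u\<^sup>2\<close>.  So the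
  vectors \<open>(u, c, e)\<close> must be isotropic for a quadratic form.  Given the recurrence
  \<open>v\<^sub>n\<^sub>+\<^sub>3 = 2 v\<^sub>n\<^sub>+\<^sub>2 + 2 v\<^sub>n\<^sub>+\<^sub>1 - v\<^sub>n\<close>, the property that three consecutive vectors are isotropic
  with equal pairwise products is preserved by a shift.
\<close>

lemma coeff_seq_mult: "coeff_seq (k * p) (k * q) (k * r) n = k * coeff_seq p q r n"
  by (induction p q r n rule: coeff_seq.induct) (simp_all add: algebra_simps)

lemma coeff_seq_add:
  "coeff_seq (p + p') (q + q') (r + r') n = coeff_seq p q r n + coeff_seq p' q' r' n"
  by (induction p q r n rule: coeff_seq.induct) (simp_all add: algebra_simps)

lemma isotropic_of_recurrence:
  fixes B :: "nat \<Rightarrow> nat \<Rightarrow> int"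
  assumes sym: "\<And>i j. B i j = B j i"
    and rec: "\<And>i j. B i (j + 3) = 2 * B i (j + 2) + 2 * B i (j + 1) - B i j"
    and diag: "B 0 0 = 0" "B 1 1 = 0" "B 2 2 = 0"
    and off_diag: "B 0 1 = k" "B 1 2 = k" "B 0 2 = k"
  shows "B n n = 0"
proof -
  have "B n n = 0 \<and> B (n + 1) (n + 1) = 0 \<and> B (n + 2) (n + 2) = 0
      \<and> B n (n + 1) = k \<and> B (n + 1) (n + 2) = k \<and> B n (n + 2) = k"
  proof (induction n)
    case 0
    then show ?case
      using diag off_diag by (simp add: numeral_2_eq_2)
  next
    case (Suc n)
    have "B (n + 1) (n + 3) = k" "B (n + 2) (n + 3) = k" and B_0_3: "B n (n + 3) = 4 * k"
      using Suc rec[of "n + 1" n] rec[of "n + 2" n] rec[of n n]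
        sym[of "n + 1" n] sym[of "n + 2" n] sym[of "n + 2" "n + 1"] by auto
    \<comment> \<open>By the recurrence and symmetry the value is
      \<open>2 * k + 2 * k - 4 * k\<close>, the last term coming from \<open>B_0_3\<close>.\<close>
    moreover from this have "B (n + 3) (n + 3) = 0"
      using rec[of "n + 3" n] sym[of "n + 3" n] sym[of "n + 3" "n + 1"] sym[of "n + 3" "n + 2"]
      by auto
    ultimately show ?case
      using Suc by (simp add: numeral_2_eq_2 numeral_3_eq_3)
  qed
  then show ?thesis
    by blast
qed

lemma coeff_seq_quadratic_identity:
  fixes n :: nat
  defines "u \<equiv> coeff_seq 1 2 (-3)" and "v \<equiv> coeff_seq 1 (-10) 3" and "w \<equiv> coeff_seq 1 2 3"
  shows "v n ^ 2 + v n * w n + w n ^ 2 = 3 * u n ^ 2"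
proof -
  \<comment> \<open>The polar form of \<open>3 u^2 - v^2 - v w - w^2\<close>; its diagonal is twice
    that form, which keeps the coefficients integral.\<close>
  define B where "B i j = 6 * u i * u j - 2 * v i * v j - v i * w j - w i * v j - 2 * w i * w j"
    for i j
  have "B n n = 0"
  proof (rule isotropic_of_recurrence[where B = B and k = 36])
    show "B i j = B j i" for i j
      by (simp add: B_def)
    show "B i (j + 3) = 2 * B i (j + 2) + 2 * B i (j + 1) - B i j" for i j
      by (simp add: B_def u_def v_def w_def numeral_2_eq_2 numeral_3_eq_3)
        (simp add: algebra_simps)
    show "B 0 0 = 0" "B 1 1 = 0" "B 2 2 = 0" "B 0 1 = 36" "B 1 2 = 36" "B 0 2 = 36"
      by (simp_all add: B_def u_def v_def w_def numeral_2_eq_2)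
  qed
  then show ?thesis
    by (simp add: B_def power2_eq_square)
qed

theorem theorem2p8:
  fixes a b c d e f :: "nat \<Rightarrow> int"
  assumes "int_gf a = (4 - 16 * fps_X + 12 * fps_X ^ 2) / D"
    and "int_gf b = (3 + 6 * fps_X - 9 * fps_X ^ 2) / D"
    and "int_gf c = (2 - 20 * fps_X + 6 * fps_X ^ 2) / D"
    and "int_gf d = (4 + 8 * fps_X - 12 * fps_X ^ 2) / D"
    and "int_gf e = (2 + 4 * fps_X + 6 * fps_X ^ 2) / D"
    and "int_gf f = (5 + 10 * fps_X - 15 * fps_X ^ 2) / D"
  shows "\<forall>n. a n ^ 4 + b n ^ 4 + c n ^ 4 + d n ^ 4 + e n ^ 4 = f n ^ 4"
proof
  fix n
  define u where "u = coeff_seq 1 2 (-3) n"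
  define v where "v = coeff_seq 1 (-10) 3 n"
  define w where "w = coeff_seq 1 2 3 n"
  have "a = coeff_seq 4 (-16) 12" "b = coeff_seq 3 6 (-9)" "c = coeff_seq 2 (-20) 6"
    "d = coeff_seq 4 8 (-12)" "e = coeff_seq 2 4 6" "f = coeff_seq 5 10 (-15)"
    using assms by (simp_all add: int_gf_eq_iff [symmetric] int_gf_coeff_seq)
  then have seqs: "a n = 2 * (v + w)" "b n = 3 * u" "c n = 2 * v" "d n = 4 * u" "e n = 2 * w"
      "f n = 5 * u"
    using coeff_seq_add[of 1 1 "-10" 2 3 3 n] coeff_seq_mult[of 2 2 "-8" 6 n]
      coeff_seq_mult[of 3 1 2 "-3" n] coeff_seq_mult[of 4 1 2 "-3" n]
      coeff_seq_mult[of 5 1 2 "-3" n] coeff_seq_mult[of 2 1 "-10" 3 n]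
      coeff_seq_mult[of 2 1 2 3 n]
    by (simp_all add: u_def v_def w_def)
  have "(v + w) ^ 4 + v ^ 4 + w ^ 4 = 2 * (v ^ 2 + v * w + w ^ 2) ^ 2"
    by algebra
  also have "\<dots> = 18 * u ^ 4"
    using coeff_seq_quadratic_identity[of n]
    by (simp add: u_def v_def w_def power_mult_distrib flip: power_mult)
  \<comment> \<open>After scaling by \<open>2 ^ 4\<close>: 16 * 18 = 288 = 5^4 - 3^4 - 4^4.\<close>
  finally show "a n ^ 4 + b n ^ 4 + c n ^ 4 + d n ^ 4 + e n ^ 4 = f n ^ 4"
    unfolding seqs power_mult_distrib by simp
qed

end
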